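(* Let $q$ be an odd prime power, $\mathbb{A}=\mathbb{F}_q[X]$, and $S\subseteq\mathbb{F}_q^*$ any set with $|S|=(q-1)/2$ such that $\alpha\in S$ implies $-\alpha\notin S$. Let $f=aP_1^{e_1}P_2^{e_2}$, where $a\in\mathbb{F}_q^*$, $P_1\ne P_2$ are monic irreducible polynomials and $e_1,e_2\ge1$. If either (1) $q\equiv1\pmod4$, or (2) $q\equiv 3\pmod4$ and both $\deg P_1$ and $\deg P_2$ are even, then $$G(f,S)\equiv\left(\frac{P_1}{P_2}\right)\pmod f;$$ otherwise, $G(f,S)\not\equiv\pm1\pmod f$.
   Context: For non-zero $g\in\mathbb{A}$, $\mathrm{sgn}(g)$ is the leading coefficient of $g$. $G(f,S)=\prod g$, the product over all non-zero $g\in\mathbb{A}$ with $\mathrm{sgn}(g)\in S$, $0\le\deg g<\deg f$, $\gcd(g,f)=1$. For a monic irreducible $P$ and $g$ coprime to $P$, $\left(\frac gP\right)=\pm1$ is the Legendre symbol, defined by $\left(\frac gP\right)\equiv g^{(q^{\deg P}-1)/2}\pmod P$. *)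

theory Defs
  imports
    "HOL-Computational_Algebra.Polynomial"
    "HOL-Number_Theory.Cong"
    "HOL-Library.Cardinality"
begin

(* Throughout, the finite field F_q is a type 'a of sort {finite, field}, with q = CARD('a). *)

definition legendre_poly :: "'a::{finite, field} poly \<Rightarrow> 'a poly \<Rightarrow> int" where
  (* Meaningful only for q odd, P monic irreducible and g coprime to P: then exactly one of
     the two signs satisfies the congruence. *)
  "legendre_poly g P =
     (THE s. s \<in> {1, - 1} \<and> [of_int s = g ^ ((CARD('a) ^ degree P - 1) div 2)] (mod P))"

definition G_index :: "'a::{finite, field} poly \<Rightarrow> 'a set \<Rightarrow> 'a poly set" where
  "G_index f S = {g. g \<noteq> 0 \<and> lead_coeff g \<in> S \<and> degree g < degree f \<and> coprime g f}"

definition G_prod :: "'a::{finite, field} poly \<Rightarrow> 'a set \<Rightarrow> 'a poly" where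
  "G_prod f S = \<Prod> (G_index f S)"

(* The index set is finite, so the product above never takes the default value 1 that
   HOL assigns to products over infinite sets. *)
lemma finite_G_index: "finite (G_index f S)"
proof (rule finite_subset)
  show "G_index f S \<subseteq> Poly ` {xs. set xs \<subseteq> UNIV \<and> length xs \<le> degree f}"
  proof
    fix g assume "g \<in> G_index f S"
    then have "degree g < degree f"
      by (simp add: G_index_def)
    then have "length (coeffs g) \<le> degree f"
      by (simp add: coeffs_def)
    then have "coeffs g \<in> {xs. set xs \<subseteq> UNIV \<and> length xs \<le> degree f}"
      by simp
    moreover have "g = Poly (coeffs g)"
      by simp
    ultimately show "g \<in> Poly ` {xs. set xs \<subseteq> UNIV \<and> length xs \<le> degree f}"
      by (rule rev_image_eqI)
  qed
  show "finite (Poly ` {xs. set xs \<subseteq> (UNIV :: 'a set) \<and> length xs \<le> degree f})"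
    by (rule finite_imageI, rule finite_lists_length_le, rule finite)
qed

end

theory Submission
  imports Defs
begin

text \<open>
  As in Rousseau's proof of quadratic reciprocity, compare two half systems (sets containing
  exactly one of \<open>g\<close> and \<open>- g\<close>) of the units modulo \<open>F1 * F2\<close>, where \<open>Fi = Pi ^ ei\<close>:
  their products agree up to a global sign. One is the index set of \<open>G(f, S)\<close>; the other
  consists of the \<open>g\<close> whose residue modulo \<open>F2\<close> has leading coefficient in \<open>S\<close>. Writing
  \<open>mi\<close> for half the number of units modulo \<open>Fi\<close>, Wilson's theorem shows that the second product
  is \<open>(- 1) ^ m2\<close> modulo \<open>F1\<close> and \<open>(- 1) ^ ((m2 + 1) * m1)\<close> modulo \<open>F2\<close>. These signs agree if
  and only if \<open>m1\<close> and \<open>m2\<close> are both even, which is the case distinction of the theorem.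
  When they agree, the global sign is found modulo \<open>F2\<close> by a direct evaluation as in Gauss's lemma.
\<close>

section \<open>Coprimality and congruences in a Euclidean ring\<close>

text \<open>
  The library versions of the following facts assume a ring with a gcd operation. Polynomials over
  an arbitrary field are not an instance of that class.
\<close>

lemma bezout_dvd:
  fixes a b :: "'a::unique_euclidean_ring"
  shows "\<exists>u v. u * a + v * b dvd a \<and> u * a + v * b dvd b"
proof (induction "euclidean_size b" arbitrary: a b rule: less_induct)
  case less
  show ?case
  proof (cases "b = 0")
    case True
    then show ?thesis by (intro exI[of _ 1] exI[of _ 0]) simp
  next
    case False
    then have "euclidean_size (a mod b) < euclidean_size b"
      by (rule mod_size_less)
    from less[OF this, of b] obtain u v
      where d: "u * b + v * (a mod b) dvd b" "u * b + v * (a mod b) dvd a mod b" by auto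
    have eq: "v * a + (u - v * (a div b)) * b = u * b + v * (a mod b)"
      by (simp add: algebra_simps minus_div_mult_eq_mod[symmetric])
    have "u * b + v * (a mod b) dvd a"
      using d dvd_mod_iff by blast
    with d(1) eq show ?thesis by metis
  qed
qed

text \<open>Bezout coefficients supply the inverse. Reading coprimality as invertibility turns the
  product rule, cancellation and the gluing of congruences below into computations with
  inverses.\<close>

lemma coprime_iff_cong_inverse:
  fixes g m :: "'a::unique_euclidean_ring"
  shows "coprime g m \<longleftrightarrow> (\<exists>h. [g * h = 1] (mod m))"
proof
  assume c: "coprime g m"
  obtain u v where d: "u * g + v * m dvd g" "u * g + v * m dvd m"
    using bezout_dvd by blast
  then have "u * g + v * m dvd 1"
    using c coprime_common_divisor by blast
  then obtain w where "1 = (u * g + v * m) * w" by (elim dvdE)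
  then have "g * (u * w) - 1 = m * (- v * w)"
    by (simp add: algebra_simps)
  then have "[g * (u * w) = 1] (mod m)"
    by (metis cong_iff_dvd_diff dvd_triv_left)
  then show "\<exists>h. [g * h = 1] (mod m)" ..
next
  assume "\<exists>h. [g * h = 1] (mod m)"
  then obtain h where "[1 = g * h] (mod m)" by (auto simp: cong_sym_eq)
  then have "coprime (g * h) m"
    using coprime_cong_transfer_left coprime_1_left by blast
  then show "coprime g m"
    by (meson coprime_divisors dvd_refl dvd_triv_left)
qed

lemma coprime_mult_left_ring:
  fixes a b m :: "'a::unique_euclidean_ring"
  shows "coprime (a * b) m \<longleftrightarrow> coprime a m \<and> coprime b m"
proof
  assume "coprime (a * b) m"
  then show "coprime a m \<and> coprime b m"
    by (meson coprime_divisors dvd_refl dvd_triv_left dvd_triv_right)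
next
  assume "coprime a m \<and> coprime b m"
  then obtain h k where "[a * h = 1] (mod m)" "[b * k = 1] (mod m)"
    by (auto simp: coprime_iff_cong_inverse)
  then have "[(a * h) * (b * k) = 1 * 1] (mod m)"
    by (rule cong_mult)
  then show "coprime (a * b) m"
    unfolding coprime_iff_cong_inverse by (intro exI[of _ "h * k"]) (simp add: ac_simps)
qed

lemma coprime_mult_right_ring:
  fixes a b m :: "'a::unique_euclidean_ring"
  shows "coprime m (a * b) \<longleftrightarrow> coprime m a \<and> coprime m b"
  using coprime_mult_left_ring by (metis coprime_commute)

lemma coprime_power_left_ring:
  fixes a m :: "'a::unique_euclidean_ring"
  shows "coprime a m \<Longrightarrow> coprime (a ^ n) m"
  by (induction n) (auto simp: coprime_mult_left_ring)

lemma coprime_power_right_ring: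
  fixes a m :: "'a::unique_euclidean_ring"
  assumes "0 < n"
  shows "coprime m (a ^ n) \<longleftrightarrow> coprime m a"
  using assms by (induction n rule: nat_induct_non_zero) (auto simp: coprime_mult_right_ring)

lemma coprime_prod_left_ring:
  fixes m :: "'a::unique_euclidean_ring"
  shows "(\<And>x. x \<in> A \<Longrightarrow> coprime x m) \<Longrightarrow> coprime (\<Prod>A) m"
  by (induction A rule: infinite_finite_induct) (auto simp: coprime_mult_left_ring)

lemma cong_mult_lcancel_ring:
  fixes k m :: "'a::unique_euclidean_ring"
  assumes "coprime k m"
  shows "[k * a = k * b] (mod m) \<longleftrightarrow> [a = b] (mod m)"
proof
  obtain h where h: "[k * h = 1] (mod m)"
    using assms coprime_iff_cong_inverse by blast
  assume "[k * a = k * b] (mod m)"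
  then have *: "[h * (k * a) = h * (k * b)] (mod m)"
    by (rule cong_scalar_left)
  have **: "[h * (k * c) = c] (mod m)" for c
    using cong_scalar_right[OF h, of c] by (simp add: ac_simps)
  show "[a = b] (mod m)"
    using * ** by (meson cong_sym cong_trans)
qed (rule cong_scalar_left)

lemma cong_mult_moduli_ring:
  fixes a b m n :: "'a::unique_euclidean_ring"
  assumes "[a = b] (mod m)" "[a = b] (mod n)" "coprime m n"
  shows "[a = b] (mod (m * n))"
proof -
  obtain k where k: "a - b = m * k"
    using assms(1) by (auto simp: cong_iff_dvd_diff elim: dvdE)
  have "[m * k = m * 0] (mod n)"
    using assms(2) k by (simp add: cong_iff_dvd_diff)
  then have "[k = 0] (mod n)"
    using assms(3) cong_mult_lcancel_ring by blast
  then show ?thesis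
    by (simp add: cong_iff_dvd_diff k cong_0_iff mult_dvd_mono)
qed

lemma irreducible_coprime_iff:
  fixes p g :: "'a::field poly"
  assumes "irreducible p"
  shows "coprime g p \<longleftrightarrow> \<not> p dvd g"
proof
  assume "coprime g p"
  then show "\<not> p dvd g"
    using assms by (metis coprime_common_divisor dvd_refl irreducible_not_unit)
next
  assume n: "\<not> p dvd g"
  show "coprime g p"
  proof (rule coprimeI)
    fix c assume c: "c dvd g" "c dvd p"
    then obtain d where d: "p = c * d" by (elim dvdE)
    with assms have "is_unit c \<or> is_unit d" by (rule irreducibleD)
    moreover have "\<not> is_unit d"
    proof
      assume "is_unit d"
      then have "p dvd c" using d by simp
      then show False using c n dvd_trans by blast
    qed
    ultimately show "is_unit c" by blast
  qed
qed

section \<open>Reduced residues modulo a polynomial: counting, Euler and Wilson\<close>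

definition polys_below :: "nat \<Rightarrow> 'a::zero poly set" where
  "polys_below n = {g. g = 0 \<or> degree g < n}"

text \<open>Splitting off the constant coefficient with \<open>pCons\<close> multiplies the count by
  \<open>CARD('a)\<close> and raises the bound by one.\<close>

lemma card_polys_below:
  "finite (polys_below n :: 'a::{finite, zero} poly set)
    \<and> card (polys_below n :: 'a poly set) = CARD('a) ^ n"
proof (induction n)
  case 0
  then show ?case by (simp add: polys_below_def)
next
  case (Suc n)
  have bij: "bij_betw (\<lambda>(c, p). pCons c p) (UNIV \<times> (polys_below n :: 'a poly set)) (polys_below (Suc n))"
  proof (rule bij_betw_imageI)
    show "inj_on (\<lambda>(c, p). pCons c p) (UNIV \<times> (polys_below n :: 'a poly set))"
      by (auto simp: inj_on_def)
    show "(\<lambda>(c, p). pCons c p) ` (UNIV \<times> (polys_below n :: 'a poly set)) = polys_below (Suc n)"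
    proof (intro equalityI subsetI)
      fix g :: "'a poly" assume "g \<in> polys_below (Suc n)"
      moreover obtain c p where "g = pCons c p" by (cases g)
      ultimately have "p \<in> polys_below n"
        by (auto simp: polys_below_def split: if_splits)
      with \<open>g = pCons c p\<close> show "g \<in> (\<lambda>(c, p). pCons c p) ` (UNIV \<times> polys_below n)" by auto
    qed (auto simp: polys_below_def split: if_splits)
  qed
  show ?case
    using Suc bij_betw_same_card[OF bij] bij_betw_finite[OF bij]
    by (simp add: card_cartesian_product finite_cartesian_product)
qed

lemma finite_polys_below [simp]: "finite (polys_below n :: 'a::{finite, zero} poly set)"
  using card_polys_below by blast

text \<open>The unit group of the residue ring modulo \<open>m\<close>, represented by reduced
  remainders so that products and cardinalities are those of concrete finite sets.\<close>

definition units_mod :: "'a::field poly \<Rightarrow> 'a poly set" where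
  "units_mod m = {g \<in> polys_below (degree m). coprime g m}"

lemma finite_units_mod [simp]: "finite (units_mod (m :: 'a::{finite, field} poly))"
  by (simp add: units_mod_def)

lemma uminus_in_units_mod [simp]: "- g \<in> units_mod m \<longleftrightarrow> g \<in> units_mod m"
proof -
  have "coprime (- g) m \<longleftrightarrow> coprime g m"
    by (metis coprimeI coprime_common_divisor dvd_minus_iff)
  then show ?thesis by (simp add: units_mod_def polys_below_def)
qed

lemma mod_in_units_mod:
  assumes "m \<noteq> 0" "coprime g m"
  shows "g mod m \<in> units_mod m"
  using assms degree_mod_less[of m g] by (auto simp: units_mod_def polys_below_def)

lemma polys_below_mod [simp]: "g \<in> polys_below (degree m) \<Longrightarrow> g mod m = (g :: 'a::field poly)"
  by (auto simp: polys_below_def mod_poly_less)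

lemma units_mod_cong_imp_eq:
  "g \<in> units_mod m \<Longrightarrow> h \<in> units_mod m \<Longrightarrow> [g = h] (mod m) \<Longrightarrow> g = h"
  by (auto simp: units_mod_def cong_def)

lemma is_unit_poly_degree: "is_unit (m :: 'a::field poly) \<Longrightarrow> degree m = 0"
  by (metis is_unit_iff_degree not_is_unit_0)

lemma zero_notin_units_mod: "0 < degree m \<Longrightarrow> 0 \<notin> units_mod m"
  by (auto simp: units_mod_def dest: is_unit_poly_degree)

lemma coprime_prod_units_mod: "A \<subseteq> units_mod m \<Longrightarrow> coprime (\<Prod>A) m"
  by (rule coprime_prod_left_ring) (auto simp: units_mod_def)

text \<open>Multiplication by \<open>x\<close> permutes the reduced residues, so their product is
  unchanged up to congruence when each factor is multiplied by \<open>x\<close>; this product is a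
  unit and cancels.\<close>

lemma euler_units_mod:
  fixes m :: "'a::{finite, field} poly"
  assumes "m \<noteq> 0" "coprime x m"
  shows "[x ^ card (units_mod m) = 1] (mod m)"
proof -
  let ?f = "\<lambda>g. (x * g) mod m"
  have inj: "inj_on ?f (units_mod m)"
  proof (rule inj_onI)
    fix g h assume gh: "g \<in> units_mod m" "h \<in> units_mod m" "?f g = ?f h"
    then have "[x * g = x * h] (mod m)" by (simp add: cong_def)
    with assms gh show "g = h"
      by (simp add: cong_mult_lcancel_ring units_mod_cong_imp_eq)
  qed
  have sub: "?f ` units_mod m \<subseteq> units_mod m"
    using assms by (intro image_subsetI mod_in_units_mod) (auto simp: coprime_mult_left_ring units_mod_def)
  have img: "?f ` units_mod m = units_mod m"
    by (rule card_subset_eq) (use inj sub in \<open>auto simp: card_image\<close>)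
  have "[\<Prod>(units_mod m) = (\<Prod>g\<in>units_mod m. x * g)] (mod m)"
  proof -
    have "\<Prod>(units_mod m) = \<Prod>(?f ` units_mod m)" by (simp add: img)
    also have "\<dots> = (\<Prod>g\<in>units_mod m. ?f g)"
      using inj by (subst prod.reindex) auto
    also have "[\<dots> = (\<Prod>g\<in>units_mod m. x * g)] (mod m)"
      by (rule cong_prod) simp
    finally show ?thesis .
  qed
  then have "[\<Prod>(units_mod m) * x ^ card (units_mod m) = \<Prod>(units_mod m) * 1] (mod m)"
    by (simp add: prod.distrib cong_sym_eq mult.commute)
  then show ?thesis
    using cong_mult_lcancel_ring[OF coprime_prod_units_mod[OF subset_refl]] by blast
qed

text \<open>The factors cancel in pairs: the induction removes \<open>x\<close> and its partner
  \<open>i x\<close>, and the rest is again closed under the involution.\<close>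

lemma prod_involution_cong_1:
  fixes m :: "'a::unique_euclidean_ring"
  assumes "finite A"
    and "\<And>x. x \<in> A \<Longrightarrow> i x \<in> A" "\<And>x. x \<in> A \<Longrightarrow> i (i x) = x" "\<And>x. x \<in> A \<Longrightarrow> i x \<noteq> x"
    and "\<And>x. x \<in> A \<Longrightarrow> [x * i x = 1] (mod m)"
  shows "[\<Prod>A = 1] (mod m)"
  using assms
proof (induction A rule: finite_psubset_induct)
  case (psubset A)
  show ?case
  proof (cases "A = {}")
    case False
    then obtain x where x: "x \<in> A" by auto
    let ?B = "A - {x, i x}"
    have "[\<Prod>?B = 1] (mod m)"
    proof (rule psubset.IH)
      show "?B \<subset> A" using x by auto
      show "i y \<in> ?B" if "y \<in> ?B" for y
        using that x psubset.prems(1,2) by (metis DiffD1 DiffD2 DiffI insert_iff singletonD)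
    qed (use psubset.prems in auto)
    moreover have "\<Prod>A = (x * i x) * \<Prod>?B"
    proof -
      have A: "A = insert x (insert (i x) ?B)" using x psubset.prems(1) by auto
      have "\<Prod>(insert x (insert (i x) ?B)) = x * (i x * \<Prod>?B)"
        using psubset.hyps psubset.prems(3)[OF x] by (subst prod.insert; simp)
      then show ?thesis using A by (simp add: mult.assoc)
    qed
    ultimately show ?thesis
      using cong_mult[OF psubset.prems(4)[OF x]] by fastforce
  qed simp
qed

text \<open>Every unit is paired with its inverse. By \<open>sqrt\<close> only 1 and -1 are their
  own inverses, and \<open>ne\<close> ensures that they are two different factors.\<close>

lemma wilson_units_mod:
  fixes m :: "'a::{finite, field} poly"
  assumes deg: "0 < degree m" and ne: "\<not> [1 = - 1] (mod m)"
    and sqrt: "\<And>x. [x * x = 1] (mod m) \<Longrightarrow> [x = 1] (mod m) \<or> [x = - 1] (mod m)"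
  shows "[\<Prod>(units_mod m) = - 1] (mod m)"
proof -
  have m0: "m \<noteq> 0" using deg by auto
  define i where "i x = (SOME y. y \<in> units_mod m \<and> [x * y = 1] (mod m))" for x
  have i: "i x \<in> units_mod m" "[x * i x = 1] (mod m)" if x: "x \<in> units_mod m" for x
  proof -
    obtain h where h: "[x * h = 1] (mod m)"
      using x coprime_iff_cong_inverse unfolding units_mod_def by blast
    then have "coprime h m" by (metis coprime_iff_cong_inverse mult.commute)
    then have "h mod m \<in> units_mod m" using m0 by (simp add: mod_in_units_mod)
    moreover have "[x * (h mod m) = 1] (mod m)"
      using h by (simp add: cong_def mod_mult_right_eq)
    ultimately have "\<exists>y. y \<in> units_mod m \<and> [x * y = 1] (mod m)" by blast
    then have "i x \<in> units_mod m \<and> [x * i x = 1] (mod m)"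
      unfolding i_def by (rule someI_ex)
    then show "i x \<in> units_mod m" "[x * i x = 1] (mod m)" by auto
  qed
  have i_eq: "i x = y" if "x \<in> units_mod m" "y \<in> units_mod m" "[x * y = 1] (mod m)" for x y
  proof -
    have "[x * i x = x * y] (mod m)" using that i(2) by (meson cong_sym cong_trans)
    moreover have "coprime x m" using that by (simp add: units_mod_def)
    ultimately show ?thesis
      using that i(1) cong_mult_lcancel_ring units_mod_cong_imp_eq by blast
  qed
  have one: "1 \<in> units_mod m" "- 1 \<in> units_mod m"
    using deg by (simp_all add: units_mod_def polys_below_def is_unit_left_imp_coprime)
  have ne': "(1::'a poly) \<noteq> - 1" using ne by (metis cong_refl)
  let ?A = "units_mod m - {1, - 1}"
  have "[\<Prod>?A = 1] (mod m)"
  proof (rule prod_involution_cong_1[where i = i])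
    fix x assume "x \<in> ?A"
    then have x: "x \<in> units_mod m" "x \<noteq> 1" "x \<noteq> - 1" by auto
    show "[x * i x = 1] (mod m)" using i x by auto
    show ii: "i (i x) = x" using i x by (intro i_eq) (auto simp: mult.commute)
    \<comment> \<open>Since \<open>i\<close> is an involution fixing 1 and -1, it cannot send any
      other element to one of them.\<close>
    have fixp: "i 1 = 1" "i (- 1) = - 1" using one by (auto intro: i_eq)
    then show "i x \<in> ?A" using x ii i(1)[OF x(1)] by auto
    show "i x \<noteq> x"
    proof
      assume "i x = x"
      then have "[x * x = 1] (mod m)" using i(2)[OF x(1)] by simp
      then show False using sqrt x one units_mod_cong_imp_eq by metis
    qed
  qed simp
  moreover have "\<Prod>(units_mod m) = - \<Prod>?A"
  proof -
    have "units_mod m = insert 1 (insert (- 1) ?A)" using one by auto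
    moreover have "\<Prod>(insert 1 (insert (- 1) ?A)) = - \<Prod>?A"
      using ne' by (subst prod.insert; simp)
    ultimately show ?thesis by simp
  qed
  ultimately show ?thesis by (simp add: cong_minus_minus_iff)
qed

text \<open>Otherwise \<open>m\<close> would divide 2, which is a nonzero constant and hence a unit.
  This is what makes signs readable from congruences.\<close>

lemma not_1_cong_minus_1:
  fixes m :: "'a::field poly"
  assumes "(2::'a) \<noteq> 0" "0 < degree m"
  shows "\<not> [1 = - 1] (mod m)"
proof
  assume "[1 = - 1] (mod m)"
  then have "m dvd 2" by (simp add: cong_iff_dvd_diff)
  moreover have "is_unit (2::'a poly)"
    using assms(1) by (simp add: numeral_poly is_unit_const_poly_iff dvd_field_iff)
  ultimately have "is_unit m" by (rule dvd_trans)
  then show False using assms(2) is_unit_poly_degree[of m] by simp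
qed

lemma irreducible_poly_degree: "irreducible (P :: 'a::field poly) \<Longrightarrow> 0 < degree P"
  by (metis gr0I is_unit_iff_degree irreducible_not_unit not_irreducible_zero)

text \<open>The factors \<open>x - 1\<close> and \<open>x + 1\<close> differ by the unit 2, so
  \<open>P\<close> divides at most one of them. The other is a unit modulo \<open>P ^ e\<close> and
  cancels from their product.\<close>

lemma sqrt_1_mod_prime_power:
  fixes P :: "'a::field poly"
  assumes two: "(2::'a) \<noteq> 0" and P: "irreducible P" and e: "0 < e"
    and x: "[x * x = 1] (mod (P ^ e))"
  shows "[x = 1] (mod (P ^ e)) \<or> [x = - 1] (mod (P ^ e))"
proof -
  have prod: "[(x - 1) * (x + 1) = 0] (mod (P ^ e))"
    using x by (simp add: cong_iff_dvd_diff algebra_simps)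
  show ?thesis
  proof (cases "P dvd x - 1")
    case False
    then have "coprime (x - 1) (P ^ e)"
      using P e by (simp add: coprime_power_right_ring irreducible_coprime_iff)
    then have "[x + 1 = 0] (mod (P ^ e))"
      using prod cong_mult_lcancel_ring[of "x - 1" "P ^ e" "x + 1" 0] by simp
    then show ?thesis by (simp add: cong_iff_dvd_diff)
  next
    case True
    have "\<not> P dvd x + 1"
    proof
      assume "P dvd x + 1"
      with True have "P dvd (x + 1) - (x - 1)" by (rule dvd_diff[rotated])
      then have "[1 = - 1] (mod P)" by (simp add: cong_iff_dvd_diff)
      then show False
        using not_1_cong_minus_1 two irreducible_poly_degree[OF P] by blast
    qed
    then have "coprime (x + 1) (P ^ e)"
      using P e by (simp add: coprime_power_right_ring irreducible_coprime_iff)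
    then have "[x - 1 = 0] (mod (P ^ e))"
      using prod cong_mult_lcancel_ring[of "x + 1" "P ^ e" "x - 1" 0] by (simp add: mult.commute)
    then show ?thesis by (simp add: cong_iff_dvd_diff)
  qed
qed

lemma degree_prime_power: "degree ((P :: 'a::field poly) ^ e) = e * degree P"
  by (cases "P = 0") (auto simp: degree_power_eq power_0_left)

text \<open>The non-units among the remainders are the multiples \<open>P * h\<close>, with
  \<open>h\<close> ranging over \<open>polys_below (k * degree P)\<close>.\<close>

lemma card_units_mod_prime_power:
  fixes P :: "'a::{finite, field} poly"
  assumes P: "irreducible P"
  shows "card (units_mod (P ^ Suc k)) = CARD('a) ^ (k * degree P) * (CARD('a) ^ degree P - 1)"
proof -
  let ?B = "polys_below (degree (P ^ Suc k)) :: 'a poly set" and ?C = "(*) P ` polys_below (k * degree P)"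
  have P0: "P \<noteq> 0" using P by auto
  have deg: "degree (P ^ Suc k) = degree P + k * degree P"
    unfolding degree_prime_power by simp
  have dvd: "P dvd g \<longleftrightarrow> g \<in> ?C" if "g \<in> ?B" for g
  proof
    assume "P dvd g"
    then obtain h where h: "g = P * h" by (elim dvdE)
    have "h \<in> polys_below (k * degree P)"
      using that P0 unfolding deg h by (cases "h = 0") (auto simp: polys_below_def degree_mult_eq)
    then show "g \<in> ?C" using h by blast
  qed auto
  have "P * h \<in> ?B" if "h \<in> polys_below (k * degree P)" for h
    using that P0 unfolding deg by (cases "h = 0") (auto simp: polys_below_def degree_mult_eq)
  then have sub: "?C \<subseteq> ?B" by blast
  have "units_mod (P ^ Suc k) = ?B - ?C"
    using dvd P by (auto simp: units_mod_def coprime_power_right_ring irreducible_coprime_iff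
        simp del: power_Suc)
  also have "card \<dots> = card ?B - card ?C"
    using sub by (intro card_Diff_subset) auto
  also have "card ?C = CARD('a) ^ (k * degree P)"
    using P0 by (subst card_image) (auto simp: inj_on_def card_polys_below)
  also have "card ?B = CARD('a) ^ degree P * CARD('a) ^ (k * degree P)"
    unfolding deg by (simp add: card_polys_below power_add)
  finally show ?thesis by (simp add: algebra_simps)
qed

section \<open>Half systems and their products\<close>

text \<open>The inequality of truth values says that exactly one of \<open>x\<close> and
  \<open>- x\<close> lies in \<open>T\<close>. In particular \<open>x\<close> and \<open>- x\<close>
  differ for \<open>x\<close> in \<open>U\<close>, so 0 is not in \<open>U\<close>.\<close>

definition half_system :: "'b::ab_group_add set \<Rightarrow> 'b set \<Rightarrow> bool" where
  "half_system T U \<longleftrightarrow> T \<subseteq> U \<and> (\<forall>x\<in>U. - x \<in> U \<and> (x \<in> T) \<noteq> (- x \<in> T))"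

lemma half_systemD:
  assumes "half_system T U"
  shows "T \<subseteq> U" "x \<in> U \<Longrightarrow> - x \<in> U" "x \<in> U \<Longrightarrow> - x \<in> T \<longleftrightarrow> x \<notin> T"
  using assms unfolding half_system_def by blast+

text \<open>Half systems pull back along odd maps. The maps used later are the leading coefficient
  and the leading coefficient of a remainder.\<close>

lemma half_system_vimage:
  assumes S: "half_system S V"
    and U: "\<And>x. x \<in> U \<Longrightarrow> - x \<in> U" "\<And>x. x \<in> U \<Longrightarrow> \<phi> x \<in> V" "\<And>x. x \<in> U \<Longrightarrow> \<phi> (- x) = - \<phi> x"
  shows "half_system {x \<in> U. \<phi> x \<in> S} U"
  unfolding half_system_def
proof (intro conjI ballI)
  fix x assume "x \<in> U"
  then show "(x \<in> {x \<in> U. \<phi> x \<in> S}) \<noteq> (- x \<in> {x \<in> U. \<phi> x \<in> S})"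
    using U half_systemD(3)[OF S, of "\<phi> x"] by simp
qed (use U in auto)

lemma half_system_split:
  assumes T: "half_system T U"
  shows "U = T \<union> uminus ` T" "T \<inter> uminus ` T = {}"
proof -
  have "x \<in> uminus ` T" if "x \<in> U" "x \<notin> T" for x
    using half_systemD(3)[OF T, of x] that by (intro image_eqI[of _ _ "- x"]) auto
  then show "U = T \<union> uminus ` T"
    using half_systemD(1,2)[OF T] by auto
  show "T \<inter> uminus ` T = {}"
    using half_systemD(1,3)[OF T] by auto
qed

lemma half_system_card:
  assumes "half_system T U" "finite U"
  shows "card U = 2 * card T"
proof -
  have "finite T" using assms half_system_split(1) by auto
  have "card U = card (T \<union> uminus ` T)"
    using half_system_split(1)[OF assms(1)] by simp
  also have "\<dots> = card T + card (uminus ` T)"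
    using \<open>finite T\<close> half_system_split(2)[OF assms(1)] by (intro card_Un_disjoint) auto
  finally show ?thesis by (simp add: card_image)
qed

lemma prod_uminus_image:
  fixes A :: "'b::comm_ring_1 set"
  shows "\<Prod>(uminus ` A) = (- 1) ^ card A * \<Prod>A"
  by (subst prod.reindex) (auto simp: prod_uminus)

text \<open>Each \<open>x\<close> in \<open>T\<close> contributes \<open>x * (- x)\<close>. Together
  with Wilson's theorem this gives the square of the product over a half system.\<close>

lemma half_system_prod:
  fixes U :: "'b::comm_ring_1 set"
  assumes "half_system T U" "finite U"
  shows "\<Prod>U = (- 1) ^ card T * (\<Prod>T * \<Prod>T)"
proof -
  have "finite T" using assms half_system_split(1) by auto
  have "\<Prod>U = \<Prod>(T \<union> uminus ` T)"
    using half_system_split(1)[OF assms(1)] by simp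
  also have "\<dots> = \<Prod>T * \<Prod>(uminus ` T)"
    using \<open>finite T\<close> half_system_split(2)[OF assms(1)] by (intro prod.union_disjoint) auto
  finally show ?thesis by (simp add: prod_uminus_image ac_simps)
qed

text \<open>\<open>T'\<close> arises from \<open>T\<close> by negating the elements of
  \<open>T - T'\<close>, so the products differ by the sign
  \<open>(- 1) ^ card (T - T')\<close>.\<close>

lemma half_system_prod_unique:
  fixes U :: "'b::comm_ring_1 set"
  assumes T: "half_system T U" and T': "half_system T' U" and fin: "finite U"
  shows "\<Prod>T' = \<Prod>T \<or> \<Prod>T' = - \<Prod>T"
proof -
  let ?A = "T \<inter> T'" and ?B = "T - T'"
  have fT: "finite T" "T \<subseteq> U" "T' \<subseteq> U"
    using T T' fin finite_subset unfolding half_system_def by auto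
  have eq: "T' = ?A \<union> uminus ` ?B"
  proof (intro equalityI subsetI)
    fix x assume x: "x \<in> T'"
    show "x \<in> ?A \<union> uminus ` ?B"
    proof (cases "x \<in> T")
      case False
      moreover have "x \<in> U" using x fT by blast
      ultimately have "- x \<in> ?B"
        using half_systemD(3)[OF T, of x] half_systemD(3)[OF T', of x] x by simp
      then show ?thesis by (intro UnI2 image_eqI[of _ _ "- x"]) auto
    qed (use x in auto)
  next
    fix x assume "x \<in> ?A \<union> uminus ` ?B"
    then show "x \<in> T'"
      using half_systemD(3)[OF T'] fT by blast
  qed
  have disj: "?A \<inter> uminus ` ?B = {}"
    using half_system_split(2)[OF T] by auto
  have "\<Prod>T' = \<Prod>(?A \<union> uminus ` ?B)" using eq by simp
  also have "\<dots> = (- 1) ^ card ?B * (\<Prod>?A * \<Prod>?B)"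
    using fT disj by (simp add: prod.union_disjoint prod_uminus_image ac_simps)
  also have "\<Prod>?A * \<Prod>?B = \<Prod>T"
    using fT by (subst prod.union_disjoint[symmetric]) (auto intro: arg_cong[where f = prod_list] simp: Int_Diff_Un)
  finally show ?thesis
    by (cases "even (card ?B)") auto
qed

text \<open>\<open>S\<close> and its negative are disjoint, and together they have as many elements
  as there are nonzero scalars, so they exhaust them.\<close>

lemma half_system_of_card:
  fixes S :: "'a::{finite, field} set"
  assumes "odd CARD('a)" "0 \<notin> S" "card S = (CARD('a) - 1) div 2" "\<And>x. x \<in> S \<Longrightarrow> - x \<notin> S"
  shows "half_system S (UNIV - {0})"
proof -
  have disj: "S \<inter> uminus ` S = {}" using assms(4) by auto
  have "card (S \<union> uminus ` S) = card S + card S"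
    using disj by (simp add: card_Un_disjoint card_image)
  also have "\<dots> = card (UNIV - {0::'a})"
    using assms(1,3) by (simp add: card_Diff_subset) presburger
  finally have "S \<union> uminus ` S = UNIV - {0}"
    using assms(2) by (intro card_subset_eq) auto
  then have "x \<in> S \<or> - x \<in> S" if "x \<noteq> 0" for x
    using that by (auto simp: set_eq_iff image_iff)
  then show ?thesis
    unfolding half_system_def using assms(2,4) by auto
qed

lemma half_system_lead_coeff:
  fixes U :: "'a::field poly set"
  assumes "half_system S (UNIV - {0})" "0 \<notin> U" "\<And>g. g \<in> U \<Longrightarrow> - g \<in> U"
  shows "half_system {g \<in> U. lead_coeff g \<in> S} U"
  by (rule half_system_vimage[OF assms(1)]) (use assms in auto)

text \<open>In characteristic 2 the elements 1 and -1 coincide, so exactly one of them cannot lie in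
  \<open>S\<close>.\<close>

lemma half_system_nonzero_imp_2_neq_0:
  assumes "half_system S (UNIV - {0::'a::field})"
  shows "(2::'a) \<noteq> 0"
proof
  assume "(2::'a) = 0"
  then have "(1::'a) = - 1" by (simp add: eq_neg_iff_add_eq_0)
  moreover have "(1 \<in> S) \<noteq> (- 1 \<in> S)"
    using half_systemD(3)[OF assms, of 1] by simp
  ultimately show False by metis
qed

section \<open>The Chinese remainder theorem for units\<close>

lemma bij_betw_crt:
  fixes F1 F2 :: "'a::field poly"
  assumes cop: "coprime F1 F2" and ne: "F1 \<noteq> 0" "F2 \<noteq> 0"
  shows "bij_betw (\<lambda>g. (g mod F1, g mod F2)) (units_mod (F1 * F2)) (units_mod F1 \<times> units_mod F2)"
proof (rule bij_betw_imageI)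
  let ?f = "\<lambda>g. (g mod F1, g mod F2)"
  show "inj_on ?f (units_mod (F1 * F2))"
  proof (rule inj_onI)
    fix g h assume "g \<in> units_mod (F1 * F2)" "h \<in> units_mod (F1 * F2)" "?f g = ?f h"
    then show "g = h"
      using cop by (auto intro!: units_mod_cong_imp_eq[of g "F1 * F2"] cong_mult_moduli_ring simp: cong_def)
  qed
  show "?f ` units_mod (F1 * F2) = units_mod F1 \<times> units_mod F2"
  proof (intro equalityI subsetI)
    fix z assume "z \<in> ?f ` units_mod (F1 * F2)"
    then show "z \<in> units_mod F1 \<times> units_mod F2"
      using ne by (auto simp: units_mod_def[of "F1 * F2"] coprime_mult_right_ring intro!: mod_in_units_mod)
  next
    fix z assume "z \<in> units_mod F1 \<times> units_mod F2"
    then obtain x y where z: "z = (x, y)" "x \<in> units_mod F1" "y \<in> units_mod F2" by auto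
    obtain k where k: "[F1 * k = 1] (mod F2)"
      using cop coprime_iff_cong_inverse by blast
    \<comment> \<open>As \<open>k\<close> inverts \<open>F1\<close> modulo \<open>F2\<close>, the
      correction term vanishes modulo \<open>F1\<close> and equals \<open>y - x\<close> modulo
      \<open>F2\<close>.\<close>
    define w where "w = x + F1 * k * (y - x)"
    have 1: "[w = x] (mod F1)"
      by (simp add: w_def cong_iff_dvd_diff mult.assoc)
    have "[w = x + 1 * (y - x)] (mod F2)"
      unfolding w_def by (intro cong_add cong_mult k) auto
    then have 2: "[w = y] (mod F2)" by simp
    have "coprime w (F1 * F2)"
      using 1 2 z by (simp add: coprime_mult_right_ring units_mod_def coprime_cong_cong_left)
    then have "w mod (F1 * F2) \<in> units_mod (F1 * F2)"
      using ne by (simp add: mod_in_units_mod)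
    moreover have "?f (w mod (F1 * F2)) = z"
      using 1 2 z by (simp add: mod_mod_cancel cong_def units_mod_def)
    ultimately show "z \<in> ?f ` units_mod (F1 * F2)" by blast
  qed
qed

text \<open>The Chinese remainder theorem turns \<open>T\<close> into the product set \<open>units_mod F1 \<times> B\<close>.\<close>

lemma prod_crt_half_system:
  fixes F1 F2 :: "'a::{finite, field} poly" and S :: "'a set"
  assumes cop: "coprime F1 F2" and ne: "F1 \<noteq> 0" "F2 \<noteq> 0"
  defines "T \<equiv> {g \<in> units_mod (F1 * F2). lead_coeff (g mod F2) \<in> S}"
    and "B \<equiv> {g \<in> units_mod F2. lead_coeff g \<in> S}"
  shows "[\<Prod>T = \<Prod>(units_mod F1) ^ card B] (mod F1)"
    and "[\<Prod>T = \<Prod>B ^ card (units_mod F1)] (mod F2)"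
proof -
  let ?f = "\<lambda>g. (g mod F1, g mod F2)"
  have bij: "bij_betw ?f (units_mod (F1 * F2)) (units_mod F1 \<times> units_mod F2)"
    by (rule bij_betw_crt[OF cop ne])
  have bijT: "bij_betw ?f T (units_mod F1 \<times> B)"
  proof (rule bij_betw_imageI)
    show "inj_on ?f T"
      using bij unfolding bij_betw_def T_def by (auto intro: inj_on_subset)
    have "?f ` T = {z \<in> ?f ` units_mod (F1 * F2). lead_coeff (snd z) \<in> S}"
      unfolding T_def by auto
    also have "\<dots> = units_mod F1 \<times> B"
      using bij unfolding bij_betw_def B_def by auto
    finally show "?f ` T = units_mod F1 \<times> B" .
  qed
  have "[\<Prod>T = (\<Prod>g\<in>T. fst (?f g))] (mod F1)"
    by (rule cong_prod) (simp add: cong_sym_eq)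
  \<comment> \<open>In the product set each unit modulo \<open>F1\<close> occurs
    \<open>card B\<close> times as a first coordinate; dually, each element of \<open>B\<close>
    occurs \<open>card (units_mod F1)\<close> times as a second one.\<close>
  also have "(\<Prod>g\<in>T. fst (?f g)) = (\<Prod>z\<in>units_mod F1 \<times> B. fst z)"
    by (rule prod.reindex_bij_betw[OF bijT])
  also have "\<dots> = (\<Prod>x\<in>units_mod F1. \<Prod>y\<in>B. x)"
    by (simp add: prod.cartesian_product case_prod_unfold del: prod_constant)
  also have "\<dots> = \<Prod>(units_mod F1) ^ card B"
    by (simp add: prod_power_distrib)
  finally show "[\<Prod>T = \<Prod>(units_mod F1) ^ card B] (mod F1)" .
  have "[\<Prod>T = (\<Prod>g\<in>T. snd (?f g))] (mod F2)"
    by (rule cong_prod) (simp add: cong_sym_eq)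
  also have "(\<Prod>g\<in>T. snd (?f g)) = (\<Prod>z\<in>units_mod F1 \<times> B. snd z)"
    by (rule prod.reindex_bij_betw[OF bijT])
  also have "\<dots> = (\<Prod>x\<in>units_mod F1. \<Prod>y\<in>B. y)"
    by (simp add: prod.cartesian_product case_prod_unfold del: prod_constant)
  also have "\<dots> = \<Prod>B ^ card (units_mod F1)"
    by simp
  finally show "[\<Prod>T = \<Prod>B ^ card (units_mod F1)] (mod F2)" .
qed

section \<open>Polynomials of bounded degree with leading coefficient in \<open>S\<close>\<close>

definition leading_in :: "'a set \<Rightarrow> nat \<Rightarrow> 'a::zero poly set" where
  "leading_in S n = {h \<in> polys_below n. lead_coeff h \<in> S}"

text \<open>These polynomials form a half system of the nonzero polynomials below the bound; the
  summand 1 accounts for the zero polynomial.\<close>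

lemma card_leading_in:
  fixes S :: "'a::{finite, field} set"
  assumes "half_system S (UNIV - {0})"
  shows "CARD('a) ^ n = 2 * card (leading_in S n) + 1"
proof -
  let ?U = "polys_below n - {0} :: 'a poly set"
  have S0: "0 \<notin> S" using half_systemD(1)[OF assms] by auto
  have "{g \<in> ?U. lead_coeff g \<in> S} = leading_in S n"
    using S0 by (auto simp: leading_in_def)
  moreover have "half_system {g \<in> ?U. lead_coeff g \<in> S} ?U"
    by (rule half_system_lead_coeff[OF assms]) (auto simp: polys_below_def)
  ultimately have "card ?U = 2 * card (leading_in S n)"
    using half_system_card[of "leading_in S n" ?U] by simp
  moreover have "card ?U = CARD('a) ^ n - 1"
  proof -
    have "(0 :: 'a poly) \<in> polys_below n" by (simp add: polys_below_def)
    then show ?thesis by (simp add: card_polys_below)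
  qed
  moreover have "0 < CARD('a) ^ n" by simp
  ultimately show ?thesis by linarith
qed

text \<open>The bound \<open>n\<close> is independent of \<open>F\<close>, so a residue class modulo
  \<open>F\<close> may be met repeatedly. For \<open>n = degree F\<close> the set is the part of
  \<open>units_mod F\<close> with leading coefficient in \<open>S\<close>.\<close>

definition units_leading_in :: "'a set \<Rightarrow> 'a::field poly \<Rightarrow> nat \<Rightarrow> 'a poly set" where
  "units_leading_in S F n = {g \<in> leading_in S n. coprime g F}"

text \<open>Division by \<open>F\<close> turns the polynomials of degree at least \<open>degree F\<close> into pairs of an
  arbitrary remainder and a quotient carrying the leading coefficient.\<close>

lemma units_leading_in_division:
  fixes F :: "'a::{finite, field} poly" and S :: "'a set"
  assumes lead: "lead_coeff F = 1" and S0: "0 \<notin> S"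
  defines "B \<equiv> units_leading_in S F (degree F)"
  shows "[\<Prod>(units_leading_in S F (degree F + M)) = \<Prod>(units_mod F) ^ card (leading_in S M) * \<Prod>B] (mod F)"
    and "card (units_leading_in S F (degree F + M)) =
      card (leading_in S M) * card (units_mod F) + card B"
proof -
  let ?N = "units_leading_in S F (degree F + M)"
  let ?L = "leading_in S M"
  let ?f = "\<lambda>g. (g mod F, g div F)"
  let ?H = "{g \<in> ?N. degree F \<le> degree g}"
  have F0: "F \<noteq> 0" using lead by auto
  have fin: "finite ?N" "finite ?L"
    by (auto simp: units_leading_in_def leading_in_def)
  \<comment> \<open>Adding a remainder to a nonzero multiple of \<open>F\<close> changes neither
    degree nor leading coefficient, and as \<open>F\<close> is monic the latter is that of the
    quotient \<open>h\<close>.\<close>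
  have divF: "degree (r + h * F) = degree h + degree F \<and> lead_coeff (r + h * F) = lead_coeff h
      \<and> (r + h * F) mod F = r \<and> (r + h * F) div F = h"
    if "r \<in> polys_below (degree F)" "h \<noteq> 0" for r h
  proof -
    have deg: "degree (h * F) = degree h + degree F"
      using that F0 by (simp add: degree_mult_eq)
    have "r = 0 \<or> degree r < degree (h * F)"
      using that unfolding deg by (auto simp: polys_below_def)
    then have "degree (r + h * F) = degree (h * F) \<and> lead_coeff (r + h * F) = lead_coeff (h * F)"
      using lead_coeff_add_le[of r "h * F"] by (auto simp: degree_add_eq_right)
    moreover have "(r + h * F) mod F = r"
      using that by simp
    moreover have "r div F = 0"
      using that by (auto simp: polys_below_def div_poly_less)
    moreover have "lead_coeff (h * F) = lead_coeff h"
      using lead by (simp only: lead_coeff_mult mult_1_right)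
    ultimately show ?thesis
      using deg F0 by auto
  qed
  have bij: "bij_betw ?f ?H (units_mod F \<times> ?L)"
  proof (rule bij_betw_imageI)
    show "inj_on ?f ?H"
      by (rule inj_onI) (metis div_mult_mod_eq prod.inject)
    show "?f ` ?H = units_mod F \<times> ?L"
    proof (intro equalityI subsetI)
      fix z assume "z \<in> ?f ` ?H"
      then obtain g where g: "g \<in> ?N" "degree F \<le> degree g" "z = ?f g" by auto
      let ?r = "g mod F" and ?h = "g div F"
      have g0: "g \<noteq> 0" using g(1) S0 by (auto simp: units_leading_in_def leading_in_def)
      have eq: "?r + ?h * F = g" by simp
      have r: "?r \<in> units_mod F"
        using g F0 by (intro mod_in_units_mod) (auto simp: units_leading_in_def)
      then have r': "?r \<in> polys_below (degree F)" by (simp add: units_mod_def)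
      have h0: "?h \<noteq> 0"
      proof
        assume "?h = 0"
        then have "?r = g" using eq by simp
        then show False using r' g(2) g0 by (auto simp: polys_below_def)
      qed
      have "degree g = degree ?h + degree F" "lead_coeff g = lead_coeff ?h"
        using divF[OF r' h0] unfolding eq by blast+
      then have "?h \<in> ?L"
        using g(1) g0 by (auto simp: units_leading_in_def leading_in_def polys_below_def)
      then show "z \<in> units_mod F \<times> ?L" using r g(3) by simp
    next
      fix z assume "z \<in> units_mod F \<times> ?L"
      then obtain r h where z: "z = (r, h)" "r \<in> units_mod F" "h \<in> ?L" by auto
      have h0: "h \<noteq> 0" using z S0 by (auto simp: leading_in_def)
      have r: "r \<in> polys_below (degree F)" "coprime r F" using z by (auto simp: units_mod_def)
      note d = divF[OF r(1) h0]
      have "[r + h * F = r] (mod F)" by (simp add: cong_iff_dvd_diff)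
      then have "coprime (r + h * F) F"
        using r coprime_cong_cong_left by blast
      then have "r + h * F \<in> ?H"
        using d z(3) h0 by (auto simp: units_leading_in_def leading_in_def polys_below_def)
      moreover have "?f (r + h * F) = z" using d z by simp
      ultimately show "z \<in> ?f ` ?H" by (rule rev_image_eqI[OF _ sym])
    qed
  qed
  \<comment> \<open>\<open>B\<close> is the part with quotient 0, that is, of degree below
    \<open>degree F\<close>.\<close>
  have split: "?N = ?H \<union> B" "?H \<inter> B = {}"
    using S0 by (auto simp: B_def units_leading_in_def leading_in_def polys_below_def)
  have finHB: "finite ?H" "finite B" using fin(1) by (auto simp: B_def units_leading_in_def leading_in_def)
  have "card ?N = card (?H \<union> B)"
    by (rule arg_cong[OF split(1)])
  also have "\<dots> = card ?H + card B"
    by (rule card_Un_disjoint[OF finHB split(2)])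
  also have "card ?H = card ?L * card (units_mod F)"
    using bij_betw_same_card[OF bij] by (simp add: card_cartesian_product)
  finally show "card ?N = card ?L * card (units_mod F) + card B" .
  have "[\<Prod>?H = (\<Prod>g\<in>?H. fst (?f g))] (mod F)"
    by (rule cong_prod) (simp add: cong_sym_eq)
  also have "(\<Prod>g\<in>?H. fst (?f g)) = (\<Prod>z\<in>units_mod F \<times> ?L. fst z)"
    by (rule prod.reindex_bij_betw[OF bij])
  also have "\<dots> = (\<Prod>x\<in>units_mod F. \<Prod>y\<in>?L. x)"
    by (simp add: prod.cartesian_product case_prod_unfold del: prod_constant)
  also have "\<dots> = \<Prod>(units_mod F) ^ card ?L"
    by (simp add: prod_power_distrib)
  finally have "[\<Prod>?H * \<Prod>B = \<Prod>(units_mod F) ^ card ?L * \<Prod>B] (mod F)"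
    by (rule cong_scalar_right)
  moreover have "\<Prod>?N = \<Prod>?H * \<Prod>B"
    using arg_cong[OF split(1), of "\<Prod>"] prod.union_disjoint[OF finHB split(2)] by (rule trans)
  ultimately show "[\<Prod>?N = \<Prod>(units_mod F) ^ card ?L * \<Prod>B] (mod F)" by simp
qed

text \<open>As \<open>P\<close> is monic and prime to \<open>F\<close>, its multiples in the set are
  the \<open>P * j\<close> with \<open>j\<close> in the set of the same kind whose bound is lowered
  by \<open>degree P\<close>. The factors \<open>P\<close> pulled out of them later yield the
  Legendre symbol.\<close>

lemma prod_units_leading_in_split:
  fixes P F :: "'a::{finite, field} poly"
  assumes P: "irreducible P" "lead_coeff P = 1" and cop: "coprime P F"
    and S0: "0 \<notin> S" and n: "n = degree P + k"
  shows "\<Prod>(units_leading_in S F n) =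
    \<Prod>{g \<in> units_leading_in S F n. coprime g P} *
      (P ^ card (units_leading_in S F k) * \<Prod>(units_leading_in S F k))"
proof -
  let ?N = "units_leading_in S F n" and ?K = "units_leading_in S F k"
  have P0: "P \<noteq> 0" using P by auto
  have fin: "finite ?N" by (auto simp: units_leading_in_def leading_in_def)
  have K: "P * j \<in> ?N \<longleftrightarrow> j \<in> ?K" for j
  proof (cases "j = 0")
    case False
    then have deg: "degree (P * j) = degree P + degree j"
      using P0 by (simp add: degree_mult_eq)
    have "lead_coeff (P * j) = lead_coeff j"
      using P by (simp only: lead_coeff_mult mult_1_left)
    then show ?thesis
      using P0 False cop n deg
      by (auto simp: units_leading_in_def leading_in_def polys_below_def coprime_mult_left_ring)
  qed (use S0 in \<open>auto simp: units_leading_in_def leading_in_def\<close>)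
  have "{g \<in> ?N. P dvd g} = (*) P ` ?K"
    using K by (auto elim!: dvdE)
  then have eq: "{g \<in> ?N. \<not> coprime g P} = (*) P ` ?K"
    using P by (simp add: irreducible_coprime_iff)
  have "\<Prod>?N = \<Prod>({g \<in> ?N. coprime g P} \<union> {g \<in> ?N. \<not> coprime g P})"
    by (rule arg_cong[where f = "\<Prod>"]) auto
  also have "\<dots> = \<Prod>{g \<in> ?N. coprime g P} * \<Prod>{g \<in> ?N. \<not> coprime g P}"
    using fin by (intro prod.union_disjoint) auto
  also have "\<Prod>{g \<in> ?N. \<not> coprime g P} = (\<Prod>j\<in>?K. P * j)"
    unfolding eq using P0 by (subst prod.reindex) (auto simp: inj_on_def)
  also have "\<dots> = P ^ card ?K * \<Prod>?K"
    by (simp add: prod.distrib)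
  finally show ?thesis .
qed

section \<open>The Legendre symbol modulo primes and prime powers\<close>

text \<open>By Euler the power in the definition squares to 1, so it is 1 or -1 modulo
  \<open>P\<close>; as these are incongruent, the description by \<open>THE\<close> has exactly one
  solution.\<close>

lemma legendre_poly_cong:
  fixes g P :: "'a::{finite, field} poly"
  assumes two: "(2::'a) \<noteq> 0" and odd: "odd CARD('a)"
    and P: "irreducible P" and cop: "coprime g P"
  shows "legendre_poly g P \<in> {1, - 1}"
    and "[of_int (legendre_poly g P) = g ^ ((CARD('a) ^ degree P - 1) div 2)] (mod P)"
proof -
  let ?n = "(CARD('a) ^ degree P - 1) div 2"
  have "even (CARD('a) ^ degree P - 1)" using odd by simp
  then have "CARD('a) ^ degree P - 1 = ?n + ?n"
    by (simp only: mult_2[symmetric] even_two_times_div_two)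
  then have "card (units_mod P) = ?n + ?n"
    using card_units_mod_prime_power[OF P, of 0] by (simp only: power_Suc power_0 mult_0 mult_1_left mult_1_right)
  moreover have "P \<noteq> 0" using P by auto
  ultimately have "[g ^ ?n * g ^ ?n = 1] (mod P)"
    using euler_units_mod[of P g] cop by (simp add: power_add)
  then have "[g ^ ?n = 1] (mod P) \<or> [g ^ ?n = - 1] (mod P)"
    using sqrt_1_mod_prime_power[OF two P, of 1] by simp
  moreover have "\<not> [1 = - 1] (mod P)"
    using two P not_1_cong_minus_1 irreducible_poly_degree by blast
  ultimately have "\<exists>!s::int. s \<in> {1, - 1} \<and> [of_int s = g ^ ?n] (mod P)"
  proof (elim disjE)
    assume 1: "[g ^ ?n = 1] (mod P)" and ne: "\<not> [1 = - 1] (mod P)"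
    then have "\<not> [- 1 = g ^ ?n] (mod P)" by (meson cong_sym cong_trans)
    then show ?thesis using 1 by (intro ex1I[of _ 1]) (auto simp: cong_sym_eq)
  next
    assume 1: "[g ^ ?n = - 1] (mod P)" and ne: "\<not> [1 = - 1] (mod P)"
    then have "\<not> [1 = g ^ ?n] (mod P)" by (meson cong_sym cong_trans)
    then show ?thesis using 1 by (intro ex1I[of _ "- 1"]) (auto simp: cong_sym_eq)
  qed
  then have "legendre_poly g P \<in> {1, - 1}
      \<and> [of_int (legendre_poly g P) = g ^ ?n] (mod P)"
    unfolding legendre_poly_def by (rule theI')
  then show "legendre_poly g P \<in> {1, - 1}"
    and "[of_int (legendre_poly g P) = g ^ ?n] (mod P)" by auto
qed

text \<open>Half the number of units modulo \<open>P ^ e\<close> is an odd multiple of half the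
  number modulo \<open>P\<close>, so \<open>g ^ m\<close> has the right sign modulo
  \<open>P\<close>. Modulo \<open>P ^ e\<close> it is again 1 or -1, and reduction modulo
  \<open>P\<close> tells which.\<close>

lemma legendre_poly_cong_prime_power:
  fixes g P :: "'a::{finite, field} poly"
  assumes two: "(2::'a) \<noteq> 0" and odd: "odd CARD('a)"
    and P: "irreducible P" and cop: "coprime g P" and e: "0 < e"
    and m: "card (units_mod (P ^ e)) = 2 * m"
  shows "[g ^ m = of_int (legendre_poly g P)] (mod (P ^ e))"
proof -
  let ?n = "(CARD('a) ^ degree P - 1) div 2" and ?s = "of_int (legendre_poly g P) :: 'a poly"
  obtain k where k: "e = Suc k" using e by (cases e) auto
  have "even (CARD('a) ^ degree P - 1)" using odd by simp
  then have n: "2 * ?n = CARD('a) ^ degree P - 1"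
    by (rule even_two_times_div_two)
  have "2 * m = CARD('a) ^ (k * degree P) * (2 * ?n)"
    unfolding n using m card_units_mod_prime_power[OF P, of k] unfolding k by (simp only:)
  then have mn: "m = ?n * CARD('a) ^ (k * degree P)" by simp
  have s: "?s = 1 \<or> ?s = - 1" using legendre_poly_cong(1)[OF two odd P cop] by auto
  have "[?s ^ (CARD('a) ^ (k * degree P)) = (g ^ ?n) ^ (CARD('a) ^ (k * degree P))] (mod P)"
    by (rule cong_pow[OF legendre_poly_cong(2)[OF two odd P cop]])
  \<comment> \<open>The exponent is a power of the odd number \<open>CARD('a)\<close>, so it
    preserves the sign.\<close>
  moreover have "?s ^ (CARD('a) ^ (k * degree P)) = ?s"
    using s odd by auto
  ultimately have modP: "[?s = g ^ m] (mod P)"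
    unfolding mn by (simp add: power_mult)
  have "P \<noteq> 0" using P by auto
  then have "[g ^ m * g ^ m = 1] (mod (P ^ e))"
    using euler_units_mod[of "P ^ e" g] P cop e m
    by (auto simp: coprime_power_right_ring mult_2 power_add)
  then have pm: "[g ^ m = 1] (mod (P ^ e)) \<or> [g ^ m = - 1] (mod (P ^ e))"
    by (rule sqrt_1_mod_prime_power[OF two P e])
  have "P dvd P ^ e" using e by simp
  have ne: "\<not> [1 = - 1] (mod P)" "\<not> [- 1 = 1] (mod P)"
    using two P not_1_cong_minus_1 irreducible_poly_degree cong_sym by blast+
  show ?thesis
    using pm
  proof
    assume *: "[g ^ m = 1] (mod (P ^ e))"
    then have "[?s = 1] (mod P)"
      using modP \<open>P dvd P ^ e\<close> cong_dvd_mono_modulus cong_trans by blast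
    then have "?s = 1" using s ne by auto
    then show ?thesis using * by simp
  next
    assume *: "[g ^ m = - 1] (mod (P ^ e))"
    then have "[?s = - 1] (mod P)"
      using modP \<open>P dvd P ^ e\<close> cong_dvd_mono_modulus cong_trans by blast
    then have "?s = - 1" using s ne by auto
    then show ?thesis using * by simp
  qed
qed

lemma wilson_prime_power:
  fixes P :: "'a::{finite, field} poly"
  assumes "(2::'a) \<noteq> 0" "irreducible P" "0 < e"
  shows "[\<Prod>(units_mod (P ^ e)) = - 1] (mod (P ^ e))"
proof -
  have deg: "0 < degree (P ^ e)"
    using assms(3) irreducible_poly_degree[OF assms(2)] by (simp add: degree_prime_power)
  show ?thesis
    by (rule wilson_units_mod[OF deg not_1_cong_minus_1[OF assms(1) deg] sqrt_1_mod_prime_power[OF assms]])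
qed

lemma card_units_mod_half_system:
  fixes S :: "'a::{finite, field} set"
  assumes S: "half_system S (UNIV - {0})" and deg: "0 < degree F"
  shows "half_system {g \<in> units_mod F. lead_coeff g \<in> S} (units_mod F)"
    and "card (units_mod F) = 2 * card {g \<in> units_mod F. lead_coeff g \<in> S}"
proof -
  show h: "half_system {g \<in> units_mod F. lead_coeff g \<in> S} (units_mod F)"
    by (rule half_system_lead_coeff[OF S zero_notin_units_mod[OF deg]]) simp
  show "card (units_mod F) = 2 * card {g \<in> units_mod F. lead_coeff g \<in> S}"
    by (rule half_system_card[OF h]) simp
qed

section \<open>Evaluating half-system products modulo the two prime powers\<close>

text \<open>\<open>\<epsilon>\<close> is the sign between \<open>T\<close> and the half system cut
  out by the residue modulo \<open>F2\<close>. The same \<open>\<epsilon>\<close> serves both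
  moduli, so the relation between the two residues does not depend on \<open>T\<close>.\<close>

lemma prod_half_system_two_primes:
  fixes P1 P2 :: "'a::{finite, field} poly" and S :: "'a set"
  assumes S: "half_system S (UNIV - {0})"
    and P: "irreducible P1" "irreducible P2" "coprime P1 P2" and e: "0 < e1" "0 < e2"
  defines "F1 \<equiv> P1 ^ e1" and "F2 \<equiv> P2 ^ e2"
  assumes m: "card (units_mod F1) = 2 * m1" "card (units_mod F2) = 2 * m2"
    and T: "half_system T (units_mod (F1 * F2))"
  shows "\<exists>\<epsilon>\<in>{1, - 1}. [\<Prod>T = \<epsilon> * (- 1) ^ m2] (mod F1) \<and>
    [\<Prod>T = \<epsilon> * ((- 1) ^ Suc m2) ^ m1] (mod F2)"
proof -
  have two: "(2::'a) \<noteq> 0" by (rule half_system_nonzero_imp_2_neq_0[OF S])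
  have deg: "0 < degree F1" "0 < degree F2"
    using e irreducible_poly_degree P by (auto simp: F1_def F2_def degree_prime_power)
  then have ne: "F1 \<noteq> 0" "F2 \<noteq> 0" by auto
  have cop: "coprime F1 F2"
    unfolding F1_def F2_def using P e
    by (simp add: coprime_power_left_ring coprime_power_right_ring)
  let ?T' = "{g \<in> units_mod (F1 * F2). lead_coeff (g mod F2) \<in> S}"
  let ?B = "{g \<in> units_mod F2. lead_coeff g \<in> S}"
  have "half_system ?T' (units_mod (F1 * F2))"
  proof (rule half_system_vimage[OF S])
    fix g assume g: "g \<in> units_mod (F1 * F2)"
    then show "- g \<in> units_mod (F1 * F2)" by simp
    have "g mod F2 \<in> units_mod F2"
      using g ne by (intro mod_in_units_mod) (auto simp: units_mod_def coprime_mult_right_ring)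
    then show "lead_coeff (g mod F2) \<in> UNIV - {0}"
      using zero_notin_units_mod[OF deg(2)] by auto
    show "lead_coeff (- g mod F2) = - lead_coeff (g mod F2)"
      by (simp add: poly_mod_minus_left)
  qed
  from half_system_prod_unique[OF this T] have "\<Prod>T = 1 * \<Prod>?T' \<or> \<Prod>T = - 1 * \<Prod>?T'"
    by simp
  then obtain \<epsilon> :: "'a poly" where \<epsilon>: "\<epsilon> \<in> {1, - 1}" "\<Prod>T = \<epsilon> * \<Prod>?T'"
    by blast
  have hB: "half_system ?B (units_mod F2)" and cB: "card ?B = m2"
    using card_units_mod_half_system[OF S deg(2)] m by auto
  have W1: "[\<Prod>(units_mod F1) = - 1] (mod F1)" and W2: "[\<Prod>(units_mod F2) = - 1] (mod F2)"
    using wilson_prime_power two P e unfolding F1_def F2_def by blast+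
  have "[\<Prod>?T' = \<Prod>(units_mod F1) ^ m2] (mod F1)"
    using prod_crt_half_system(1)[OF cop ne, of S] cB by simp
  also have "[\<Prod>(units_mod F1) ^ m2 = (- 1) ^ m2] (mod F1)"
    by (rule cong_pow[OF W1])
  finally have 1: "[\<Prod>?T' = (- 1) ^ m2] (mod F1)" .
  \<comment> \<open>Wilson modulo \<open>F2\<close> determines the square of the product over
    \<open>?B\<close>. The square suffices, because that product enters with the even exponent
    \<open>2 * m1\<close>.\<close>
  have "(- 1) ^ m2 * \<Prod>(units_mod F2) = \<Prod>?B * \<Prod>?B"
    using half_system_prod[OF hB] cB by (simp add: mult.assoc[symmetric] power_add[symmetric])
  then have "[\<Prod>?B * \<Prod>?B = (- 1) ^ Suc m2] (mod F2)"
    using cong_scalar_left[OF W2, of "(- 1) ^ m2"] by simp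
  then have "[(\<Prod>?B * \<Prod>?B) ^ m1 = ((- 1) ^ Suc m2) ^ m1] (mod F2)"
    by (rule cong_pow)
  moreover have "[\<Prod>?T' = (\<Prod>?B * \<Prod>?B) ^ m1] (mod F2)"
    using prod_crt_half_system(2)[OF cop ne, of S] m
    by (simp add: power_mult power2_eq_square)
  ultimately have 2: "[\<Prod>?T' = ((- 1) ^ Suc m2) ^ m1] (mod F2)"
    using cong_trans by blast
  show ?thesis
    unfolding \<epsilon>(2)
    by (intro bexI[OF _ \<epsilon>(1)] conjI cong_scalar_left[OF 1] cong_scalar_left[OF 2])
qed

text \<open>Compare the polynomials of degree less than \<open>degree (F1 * F2)\<close> that are prime to \<open>F2\<close>
  with the multiples of \<open>P1\<close> among them: the quotient of the two products is the
  product in question, up to the factor \<open>P1 ^ m2\<close> coming from the multiples.\<close>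

lemma prod_leading_in_cong_legendre:
  fixes P1 P2 :: "'a::{finite, field} poly" and S :: "'a set"
  assumes S: "half_system S (UNIV - {0})" and q: "odd CARD('a)"
    and P: "irreducible P1" "irreducible P2" "coprime P1 P2" "lead_coeff P1 = 1" "lead_coeff P2 = 1"
    and e: "0 < e1" "0 < e2"
  defines "F1 \<equiv> P1 ^ e1" and "F2 \<equiv> P2 ^ e2"
  assumes m: "card (units_mod F1) = 2 * m1" "even m1"
  shows "[\<Prod>{g \<in> units_mod (F1 * F2). lead_coeff g \<in> S} = of_int (legendre_poly P1 P2)] (mod F2)"
proof -
  have two: "(2::'a) \<noteq> 0" by (rule half_system_nonzero_imp_2_neq_0[OF S])
  have S0: "0 \<notin> S" using half_systemD(1)[OF S] by auto
  have deg: "0 < degree F1" "0 < degree F2"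
    using e irreducible_poly_degree P by (auto simp: F1_def F2_def degree_prime_power)
  then have ne: "F1 \<noteq> 0" "F2 \<noteq> 0" by auto
  have lead: "lead_coeff F2 = 1"
    unfolding F2_def using P by (simp only: lead_coeff_power power_one)
  have cop: "coprime P1 F2"
    unfolding F2_def using P e by (simp add: coprime_power_right_ring)
  obtain k where k: "e1 = Suc k" using e by (cases e1) auto
  let ?s = "of_int (legendre_poly P1 P2) :: 'a poly"
  let ?T = "{g \<in> units_mod (F1 * F2). lead_coeff g \<in> S}"
  let ?B = "units_leading_in S F2 (degree F2)"
  let ?L = "\<lambda>n. card (leading_in S n)"
  \<comment> \<open>\<open>M\<close> is the degree of \<open>F1\<close> and \<open>M'\<close> that
    of \<open>F1\<close> divided by \<open>P1\<close>. Thus \<open>n\<close> bounds the degrees in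
    \<open>?T\<close>, and \<open>n'\<close> bounds the quotients of multiples of
    \<open>P1\<close>.\<close>
  define M where "M = e1 * degree P1"
  define M' where "M' = k * degree P1"
  define n where "n = degree F2 + M"
  define n' where "n' = degree F2 + M'"
  have n: "degree (F1 * F2) = n" "n = degree P1 + n'"
    using ne by (simp_all add: degree_mult_eq n_def n'_def F1_def M_def M'_def degree_prime_power k)
  have B: "?B = {g \<in> units_mod F2. lead_coeff g \<in> S}"
    by (auto simp: units_leading_in_def leading_in_def units_mod_def)
  define m2 where "m2 = card ?B"
  have m2: "card (units_mod F2) = 2 * m2"
    unfolding m2_def B by (rule card_units_mod_half_system(2)[OF S deg(2)])
  have T: "?T = {g \<in> units_leading_in S F2 n. coprime g P1}"
  proof -
    have "coprime g F1 \<longleftrightarrow> coprime g P1" for g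
      unfolding F1_def using e by (simp add: coprime_power_right_ring)
    then show ?thesis
      by (auto simp: units_leading_in_def leading_in_def units_mod_def n(1) coprime_mult_right_ring)
  qed
  \<comment> \<open>\<open>M\<close> and \<open>M'\<close> lead to Wilson signs with exponents
    \<open>?L M\<close> and \<open>?L M'\<close>. These differ by \<open>m1\<close>, so the signs
    agree as \<open>m1\<close> is even.\<close>
  have L: "?L M = ?L M' + m1"
  proof -
    have "M = degree P1 + M'" by (simp add: M_def M'_def k)
    then have "2 * ?L M + 1 = CARD('a) ^ degree P1 * CARD('a) ^ M'"
      using card_leading_in[OF S, of M] by (simp only: power_add)
    moreover have "2 * ?L M' + 1 = CARD('a) ^ M'"
      by (rule card_leading_in[OF S, symmetric])
    moreover have "2 * m1 = CARD('a) ^ M' * (CARD('a) ^ degree P1 - 1)"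
      using m(1) card_units_mod_prime_power[OF P(1), of k] unfolding F1_def k M'_def by simp
    moreover have "CARD('a) ^ M' * (CARD('a) ^ degree P1 - 1) + CARD('a) ^ M' =
        CARD('a) ^ degree P1 * CARD('a) ^ M'"
      by (simp add: right_diff_distrib' mult.commute)
    ultimately show ?thesis by linarith
  qed
  have W: "[\<Prod>(units_mod F2) ^ j = (- 1) ^ j] (mod F2)" for j
    unfolding F2_def by (rule cong_pow[OF wilson_prime_power[OF two P(2) e(2)]])
  have N: "[\<Prod>(units_leading_in S F2 (degree F2 + j)) = (- 1) ^ ?L j * \<Prod>?B] (mod F2)" for j
    using units_leading_in_division(1)[OF lead S0] cong_scalar_right[OF W] by (rule cong_trans)
  have leg: "[P1 ^ m2 = ?s] (mod F2)"
    unfolding F2_def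
    by (rule legendre_poly_cong_prime_power[OF two q P(2,3) e(2)]) (use m2 F2_def in simp)
  \<comment> \<open>The number of multiples of \<open>P1\<close> is
    \<open>2 * m2 * ?L M' + m2\<close>. Euler's theorem removes the first summand, and
    \<open>P1 ^ m2\<close> is the symbol.\<close>
  have "[(P1 ^ (2 * m2)) ^ ?L M' * P1 ^ m2 = 1 ^ ?L M' * ?s] (mod F2)"
    using euler_units_mod[OF ne(2) cop] m2 leg by (intro cong_mult cong_pow) simp_all
  then have pow: "[P1 ^ card (units_leading_in S F2 n') = ?s] (mod F2)"
    unfolding n'_def units_leading_in_division(2)[OF lead S0] m2 m2_def[symmetric]
    by (simp add: power_add power_mult[symmetric] mult.commute)
  have "\<Prod>(units_leading_in S F2 n) =
      \<Prod>?T * (P1 ^ card (units_leading_in S F2 n') * \<Prod>(units_leading_in S F2 n'))"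
    unfolding T by (rule prod_units_leading_in_split[OF P(1,4) cop S0 n(2)])
  also have "[\<dots> = \<Prod>?T * (?s * ((- 1) ^ ?L M' * \<Prod>?B))] (mod F2)"
    using pow N[of M'] unfolding n'_def by (intro cong_mult cong_refl)
  finally have "[\<Prod>?T * (?s * ((- 1) ^ ?L M' * \<Prod>?B)) = (- 1) ^ ?L M * \<Prod>?B] (mod F2)"
    using N[of M, folded n_def] by (rule cong_trans[OF cong_sym])
  moreover have "(- 1) ^ ?L M = ((- 1) ^ ?L M' :: 'a poly)"
    using L m(2) by (simp add: power_add)
  \<comment> \<open>Both sides share the sign and the product over \<open>?B\<close>, a unit modulo
    \<open>F2\<close> that can be cancelled.\<close>
  ultimately have "[((- 1) ^ ?L M' * \<Prod>?B) * (\<Prod>?T * ?s) = ((- 1) ^ ?L M' * \<Prod>?B) * 1] (mod F2)"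
    by (simp add: ac_simps)
  moreover have "coprime ((- 1) ^ ?L M' * \<Prod>?B) F2"
    using coprime_prod_units_mod[of ?B F2] unfolding B
    by (simp add: coprime_mult_left_ring coprime_power_left_ring is_unit_left_imp_coprime)
  ultimately have "[\<Prod>?T * ?s = 1] (mod F2)"
    using cong_mult_lcancel_ring by blast
  moreover have "?s = 1 \<or> ?s = - 1"
    using legendre_poly_cong(1)[OF two q P(2,3)] by auto
  ultimately show ?thesis
    using cong_minus_minus_iff[of "\<Prod>?T" "- 1" F2] by auto
qed

section \<open>Parity of the unit counts and the case distinction\<close>

text \<open>Here \<open>m\<close> is half the number of units modulo a prime power. Since
  \<open>q ^ k\<close> is odd, only divisibility of \<open>q ^ d - 1\<close> by 4 matters, and as
  \<open>q ^ 2\<close> is 1 modulo 4 this depends on \<open>d\<close> only through its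
  parity.\<close>

lemma even_half_iff:
  fixes q m d k :: nat
  assumes "odd q" and m: "2 * m = q ^ k * (q ^ d - 1)"
  shows "even m \<longleftrightarrow> [q = 1] (mod 4) \<or> even d"
proof -
  have "even m \<longleftrightarrow> 4 dvd 2 * m" by presburger
  also have "\<dots> \<longleftrightarrow> 4 dvd q ^ d - 1"
  proof -
    have "coprime 2 q" using assms(1) by simp
    then have "coprime (2 ^ 2) (q ^ k)"
      by (metis coprime_power_left_iff coprime_power_right_iff)
    then have "coprime 4 (q ^ k)" by (simp only: power2_eq_square) simp
    then show ?thesis
      unfolding m by (simp add: coprime_dvd_mult_right_iff)
  qed
  also have "\<dots> \<longleftrightarrow> [q ^ d = 1] (mod 4)"
    using assms(1) by (subst cong_altdef_nat) (auto simp: Suc_le_eq odd_pos)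
  also have "\<dots> \<longleftrightarrow> [q = 1] (mod 4) \<or> even d"
  proof -
    have q2: "[q ^ 2 = 1] (mod 4)" and q13: "q mod 4 = 1 \<or> q mod 4 = 3"
    proof -
      show q13: "q mod 4 = 1 \<or> q mod 4 = 3" using assms(1) by presburger
      have "(q mod 4) ^ 2 mod 4 = 1" using q13 by auto
      then show "[q ^ 2 = 1] (mod 4)" by (simp add: cong_def power_mod)
    qed
    have even: "[q ^ (2 * j) = 1] (mod 4)" for j
      using cong_pow[OF q2, of j] by (simp add: power_mult)
    show ?thesis
    proof (cases "even d")
      case False
      then obtain j where "d = 2 * j + 1" by (elim oddE)
      then have "[q ^ d = q] (mod 4)"
        using cong_scalar_right[OF even[of j], of q] by (simp add: mult.commute)
      then show ?thesis using False by (meson cong_sym cong_trans)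
    qed (use even in \<open>auto elim!: evenE\<close>)
  qed
  finally show ?thesis .
qed

text \<open>If \<open>Q\<close> divided \<open>P\<close>, the cofactor would be a constant, and
  comparing leading coefficients would make it 1.\<close>

lemma distinct_monic_irreducible_coprime:
  fixes P Q :: "'a::field poly"
  assumes "irreducible P" "irreducible Q" "lead_coeff P = 1" "lead_coeff Q = 1" "P \<noteq> Q"
  shows "coprime P Q"
proof -
  have "\<not> Q dvd P"
  proof
    assume "Q dvd P"
    then obtain c where c: "P = Q * c" by (elim dvdE)
    then have "is_unit c"
      using assms(1,2) irreducibleD irreducible_not_unit by blast
    then obtain d where d: "c = [:d:]"
      using is_unit_poly_degree degree_eq_zeroE by metis
    have "lead_coeff c = 1"
      using assms(3,4) unfolding c by (simp only: lead_coeff_mult mult_1_left)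
    then show False using c d assms(5) by simp
  qed
  then show ?thesis using assms(2) by (simp add: irreducible_coprime_iff)
qed

theorem theorem4p8:
  fixes q :: nat
    and S :: "'a::{finite, field} set"
    and a :: 'a
    and f P1 P2 :: "'a poly"
    and e1 e2 :: nat
  assumes "q = CARD('a)" and "odd q"
    and "0 \<notin> S" and "card S = (q - 1) div 2" and "\<And>\<alpha>. \<alpha> \<in> S \<Longrightarrow> - \<alpha> \<notin> S"
    and "a \<noteq> 0"
    and "lead_coeff P1 = 1" and "irreducible P1"
    and "lead_coeff P2 = 1" and "irreducible P2"
    and "P1 \<noteq> P2"
    and "1 \<le> e1" and "1 \<le> e2"
    and "f = smult a (P1 ^ e1 * P2 ^ e2)"
  shows "if [q = 1] (mod 4) \<or> ([q = 3] (mod 4) \<and> even (degree P1) \<and> even (degree P2))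
         then [G_prod f S = of_int (legendre_poly P1 P2)] (mod f)
         else \<not> [G_prod f S = 1] (mod f) \<and> \<not> [G_prod f S = - 1] (mod f)"
proof -
  define F1 where "F1 = P1 ^ e1"
  define F2 where "F2 = P2 ^ e2"
  have S: "half_system S (UNIV - {0})"
    using assms by (intro half_system_of_card) auto
  have two: "(2::'a) \<noteq> 0" by (rule half_system_nonzero_imp_2_neq_0[OF S])
  have odd: "odd CARD('a)" using assms by simp
  have cop: "coprime P1 P2" using assms by (intro distinct_monic_irreducible_coprime)
  have e: "0 < e1" "0 < e2" using assms by auto
  have deg: "0 < degree F1" "0 < degree F2"
    using e irreducible_poly_degree assms by (auto simp: F1_def F2_def degree_prime_power)
  have degF: "0 < degree (F1 * F2)"
    using deg by (subst degree_mult_eq) auto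
  have f: "f = smult a (F1 * F2)" by (simp add: assms F1_def F2_def)
  \<comment> \<open>\<open>f\<close> and \<open>F1 * F2\<close> differ by the unit \<open>a\<close>,
    so they define the same congruences and the same coprimality.\<close>
  have cong_f: "[x = y] (mod f) \<longleftrightarrow> [x = y] (mod (F1 * F2))" for x y
    unfolding f using assms(6) by (simp add: cong_iff_dvd_diff smult_dvd_iff)
  have "coprime g f \<longleftrightarrow> coprime g (F1 * F2)" for g
    unfolding f coprime_def using assms(6) by (simp add: dvd_smult_iff)
  then have "G_index f S = {g \<in> units_mod (F1 * F2). lead_coeff g \<in> S}"
    using zero_notin_units_mod[OF degF] assms(3,6)
    by (auto simp: G_index_def units_mod_def polys_below_def f)
  then have G: "G_prod f S = \<Prod>{g \<in> units_mod (F1 * F2). lead_coeff g \<in> S}"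
    by (simp add: G_prod_def)
  obtain m1 m2 where m: "card (units_mod F1) = 2 * m1" "card (units_mod F2) = 2 * m2"
    using card_units_mod_half_system(2)[OF S] deg by blast
  obtain k1 k2 where k: "e1 = Suc k1" "e2 = Suc k2"
    using e by (cases e1; cases e2) auto
  have "even m1 \<longleftrightarrow> [q = 1] (mod 4) \<or> even (degree P1)"
    using m(1) card_units_mod_prime_power[OF assms(8), of k1] assms(1,2)
    unfolding F1_def k by (intro even_half_iff) auto
  moreover have "even m2 \<longleftrightarrow> [q = 1] (mod 4) \<or> even (degree P2)"
    using m(2) card_units_mod_prime_power[OF assms(10), of k2] assms(1,2)
    unfolding F2_def k by (intro even_half_iff) auto
  moreover have "[q = 1] (mod 4) \<or> [q = 3] (mod 4)"
  proof -
    have "q mod 4 = 1 \<or> q mod 4 = 3" using \<open>odd q\<close> by presburger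
    then show ?thesis by (simp add: cong_def)
  qed
  ultimately have good: "[q = 1] (mod 4) \<or> ([q = 3] (mod 4) \<and> even (degree P1) \<and> even (degree P2))
      \<longleftrightarrow> even m1 \<and> even m2" by blast
  have "\<exists>\<epsilon>\<in>{1, - 1}. [G_prod f S = \<epsilon> * (- 1) ^ m2] (mod F1) \<and>
      [G_prod f S = \<epsilon> * ((- 1) ^ Suc m2) ^ m1] (mod F2)"
    unfolding G F1_def F2_def
    by (rule prod_half_system_two_primes[OF S assms(8,10) cop e m[unfolded F1_def F2_def]
        card_units_mod_half_system(1)[OF S degF[unfolded F1_def F2_def]]])
  then obtain \<epsilon> where \<epsilon>: "\<epsilon> \<in> {1, - 1}"
    "[G_prod f S = \<epsilon> * (- 1) ^ m2] (mod F1)"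
    "[G_prod f S = \<epsilon> * ((- 1) ^ Suc m2) ^ m1] (mod F2)"
    by (elim bexE conjE)
  have ne: "\<not> [1 = - 1] (mod F1)" "\<not> [- 1 = 1] (mod F1)" "\<not> [1 = - 1] (mod F2)" "\<not> [- 1 = 1] (mod F2)"
    using not_1_cong_minus_1[OF two] deg cong_sym by blast+
  show ?thesis
  proof (cases "even m1 \<and> even m2")
    case True
    let ?s = "of_int (legendre_poly P1 P2) :: 'a poly"
    have 1: "[G_prod f S = \<epsilon>] (mod F1)" and 2: "[G_prod f S = \<epsilon>] (mod F2)"
      using \<epsilon> True by auto
    have "[G_prod f S = ?s] (mod F2)"
      unfolding G F1_def F2_def
      by (rule prod_leading_in_cong_legendre[OF S odd assms(8,10) cop assms(7,9) e])
        (use m True F1_def in auto)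
    with 2 have "[?s = \<epsilon>] (mod F2)" by (metis cong_sym cong_trans)
    moreover have "?s = 1 \<or> ?s = - 1"
      using legendre_poly_cong(1)[OF two odd assms(10) cop] by auto
    \<comment> \<open>Both are signs and 1 is not congruent to -1 modulo \<open>F2\<close>, so they
      are equal as polynomials. This carries the value found modulo \<open>F2\<close> over to
      \<open>F1\<close>.\<close>
    ultimately have "?s = \<epsilon>" using \<epsilon>(1) ne by auto
    moreover have "coprime F1 F2"
      unfolding F1_def F2_def using cop e
      by (simp add: coprime_power_left_ring coprime_power_right_ring)
    ultimately have "[G_prod f S = ?s] (mod f)"
      unfolding cong_f using 1 2 by (simp add: cong_mult_moduli_ring)
    then show ?thesis using good True by simp
  next
    case False
    \<comment> \<open>A common value \<open>\<delta>\<close> would force \<open>(- 1) ^ m2\<close>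
      and \<open>((- 1) ^ Suc m2) ^ m1\<close> to be equal. For odd \<open>m2\<close> these are -1
      and 1; for even \<open>m2\<close> they are 1 and \<open>(- 1) ^ m1\<close>, so
      \<open>m1\<close> would be even too.\<close>
    have "\<not> [G_prod f S = \<delta>] (mod f)" if \<delta>: "\<delta> = 1 \<or> \<delta> = - 1" for \<delta>
    proof
      assume "[G_prod f S = \<delta>] (mod f)"
      then have "[G_prod f S = \<delta>] (mod F1)" "[G_prod f S = \<delta>] (mod F2)"
        unfolding cong_f using cong_dvd_mono_modulus dvd_triv_left dvd_triv_right by blast+
      then have "[\<epsilon> * (- 1) ^ m2 = \<delta>] (mod F1)" "[\<epsilon> * ((- 1) ^ Suc m2) ^ m1 = \<delta>] (mod F2)"
        using \<epsilon>(2,3) by (metis cong_sym cong_trans)+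
      then show False
        using False ne \<epsilon>(1) \<delta> by (cases "even m1"; cases "even m2") auto
    qed
    moreover have "\<not> ([q = 1] (mod 4) \<or> ([q = 3] (mod 4) \<and> even (degree P1) \<and> even (degree P2)))"
      using good False by blast
    ultimately show ?thesis by (subst if_not_P) blast+
  qed
qed

end
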